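(* Let $n\geq 1$. (i) The map $\mathfrak{c}$ induces a bijection $S\mapsto\mathfrak{c}(S)$ between the isolated subsemigroups of $\mathrm{K}_n$ and the subsemigroups of $(2^{\{1,\dots,n\}},\cup)$. In particular, the minimal isolated subsemigroups of $\mathrm{K}_n$ are exactly the sets $\mathrm{Nil}(X)$, $X\subseteq\{1,\dots,n\}$. (ii) The map $\mathfrak{c}$ induces a bijection $S\mapsto\mathfrak{c}(S)$ between the completely isolated subsemigroups of $\mathrm{K}_n$ and the completely isolated subsemigroups of $(2^{\{1,\dots,n\}},\cup)$.
   Context: For a positive integer $n$, Kiselman's semigroup $\mathrm{K}_n$ is the monoid (with unit element $e$) given by the monoid presentation with generators $a_1,\dots,a_n$ and relations $a_i^2=a_i$ for $i=1,\dots,n$, and $a_ia_ja_i=a_ja_ia_j=a_ja_i$ for all $1\leq i<j\leq n$. The content map $\mathfrak{c}:\mathrm{K}_n\to 2^{\{1,\dots,n\}}$ sends $w\in\mathrm{K}_n$ to the set of all $i\in\{1,\dots,n\}$ such that $a_i$ appears in a word in the generators representing $w$; this does not depend on the chosen word, and $\mathfrak{c}$ is a semigroup epimorphism onto $(2^{\{1,\dots,n\}},\cup)$. For $X\subseteq\{1,\dots,n\}$ put $\mathrm{Nil}(X)=\{w\in\mathrm{K}_n:\mathfrak{c}(w)=X\}$. A subsemigroup $T$ of a semigroup $S$ is isolated if for all $x\in S$, $x^l\in T$ for some $l\in\mathbb{N}=\{1,2,\dots\}$ implies $x\in T$. It is completely isolated if for all $x,y\in S$, $xy\in T$ implies $x\in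 T$ or $y\in T$. Subsemigroups are assumed nonempty; minimal means minimal with respect to inclusion. *)

theory Defs
  imports "HOL-Algebra.Group"
begin

section \<open>Monoid presentations\<close>

inductive_set word_cong :: "'a set \<Rightarrow> ('a list \<times> 'a list) set \<Rightarrow> ('a list \<times> 'a list) set"
  for A :: "'a set" and R :: "('a list \<times> 'a list) set"
where
  rel: "(u, v) \<in> R \<Longrightarrow> u \<in> lists A \<Longrightarrow> v \<in> lists A \<Longrightarrow> (u, v) \<in> word_cong A R"
| refl: "u \<in> lists A \<Longrightarrow> (u, u) \<in> word_cong A R"
| sym: "(u, v) \<in> word_cong A R \<Longrightarrow> (v, u) \<in> word_cong A R"
| trans: "(u, v) \<in> word_cong A R \<Longrightarrow> (v, w) \<in> word_cong A R \<Longrightarrow> (u, w) \<in> word_cong A R"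
| append: "(u, u') \<in> word_cong A R \<Longrightarrow> (v, v') \<in> word_cong A R
    \<Longrightarrow> (u @ v, u' @ v') \<in> word_cong A R"

definition presented_monoid :: "'a set \<Rightarrow> ('a list \<times> 'a list) set \<Rightarrow> 'a list set monoid" where
  "presented_monoid A R =
    \<lparr> carrier = lists A // word_cong A R,
      mult = (\<lambda>X Y. \<Union>u\<in>X. \<Union>v\<in>Y. word_cong A R `` {u @ v}),
      one = word_cong A R `` {[]} \<rparr>"

lemma word_cong_in_lists:
  assumes "(u, v) \<in> word_cong A R"
  shows "u \<in> lists A \<and> v \<in> lists A"
  using assms by induction auto

lemma equiv_word_cong: "equiv (lists A) (word_cong A R)"
  by (rule equivI)
    (auto simp: refl_on_def sym_def trans_def dest: word_cong_in_lists
      intro: word_cong.refl word_cong.sym word_cong.trans)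

lemma presented_monoid_mult:
  assumes "u \<in> lists A" "v \<in> lists A"
  shows "word_cong A R `` {u} \<otimes>\<^bsub>presented_monoid A R\<^esub> word_cong A R `` {v}
    = word_cong A R `` {u @ v}"
proof -
  let ?U = "word_cong A R `` {u}" and ?V = "word_cong A R `` {v}"
  let ?W = "word_cong A R `` {u @ v}"
  have W: "word_cong A R `` {u' @ v'} = ?W" if "u' \<in> ?U" "v' \<in> ?V" for u' v'
  proof -
    have "(u @ v, u' @ v') \<in> word_cong A R"
      using that by (intro word_cong.append) simp_all
    then show ?thesis
      by (rule equiv_class_eq[OF equiv_word_cong, symmetric])
  qed
  have ne: "?U \<noteq> {}" "?V \<noteq> {}"
    using word_cong.refl[OF assms(1)] word_cong.refl[OF assms(2)] by blast+
  have "(\<Union>u'\<in>?U. \<Union>v'\<in>?V. word_cong A R `` {u' @ v'}) = (\<Union>u'\<in>?U. \<Union>v'\<in>?V. ?W)"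
    by (rule SUP_cong[OF HOL.refl], rule SUP_cong[OF HOL.refl], rule W)
  also have "\<dots> = ?W"
    using ne by (simp only: UN_constant if_False)
  finally show ?thesis
    by (simp only: presented_monoid_def monoid.select_convs)
qed

lemma monoid_presented_monoid: "monoid (presented_monoid A R)"
proof -
  let ?M = "presented_monoid A R"
  have carr: "\<exists>u\<in>lists A. X = word_cong A R `` {u}" if "X \<in> carrier ?M" for X
    using that by (auto simp: presented_monoid_def elim!: quotientE)
  have cls: "word_cong A R `` {u} \<in> carrier ?M" if "u \<in> lists A" for u
    using that by (auto simp: presented_monoid_def intro: quotientI)
  have one: "\<one>\<^bsub>?M\<^esub> = word_cong A R `` {[]}"
    by (simp add: presented_monoid_def)
  have app: "u @ v \<in> lists A" if "u \<in> lists A" "v \<in> lists A" for u v :: "'a list"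
    using that by simp
  show ?thesis
  proof (rule monoidI)
    show "\<one>\<^bsub>?M\<^esub> \<in> carrier ?M" unfolding one by (rule cls) simp
  next
    fix X Y assume "X \<in> carrier ?M" "Y \<in> carrier ?M"
    then show "X \<otimes>\<^bsub>?M\<^esub> Y \<in> carrier ?M"
      using carr cls app presented_monoid_mult by metis
  next
    fix X Y Z assume "X \<in> carrier ?M" "Y \<in> carrier ?M" "Z \<in> carrier ?M"
    then obtain u v w where
      "u \<in> lists A" "X = word_cong A R `` {u}"
      "v \<in> lists A" "Y = word_cong A R `` {v}"
      "w \<in> lists A" "Z = word_cong A R `` {w}"
      using carr by metis
    then show "X \<otimes>\<^bsub>?M\<^esub> Y \<otimes>\<^bsub>?M\<^esub> Z = X \<otimes>\<^bsub>?M\<^esub> (Y \<otimes>\<^bsub>?M\<^esub> Z)"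
      by (simp add: presented_monoid_mult)
  next
    fix X assume "X \<in> carrier ?M"
    then obtain u where "u \<in> lists A" "X = word_cong A R `` {u}"
      using carr by metis
    then show "\<one>\<^bsub>?M\<^esub> \<otimes>\<^bsub>?M\<^esub> X = X" "X \<otimes>\<^bsub>?M\<^esub> \<one>\<^bsub>?M\<^esub> = X"
      unfolding one by (simp_all add: presented_monoid_mult)
  qed
qed


section \<open>Kiselman's semigroup and the content map\<close>

definition kiselman_relations :: "nat \<Rightarrow> (nat list \<times> nat list) set" where
  "kiselman_relations n =
    {([i, i], [i]) | i. 1 \<le> i \<and> i \<le> n}
    \<union> {([i, j, i], [j, i]) | i j. 1 \<le> i \<and> i < j \<and> j \<le> n}
    \<union> {([j, i, j], [j, i]) | i j. 1 \<le> i \<and> i < j \<and> j \<le> n}"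

definition kiselman :: "nat \<Rightarrow> nat list set monoid" where
  "kiselman n = presented_monoid {1..n} (kiselman_relations n)"

text \<open>An element \<open>w\<close> of \<^term>\<open>kiselman n\<close> is the set of all words representing it, so
  the quantifier below ranges over those words; \<open>content_eq_set\<close> shows that the
  choice of the word is irrelevant.\<close>

definition content :: "nat list set \<Rightarrow> nat set" where
  "content w = {i. \<exists>u\<in>w. i \<in> set u}"

definition Nil_of :: "nat \<Rightarrow> nat set \<Rightarrow> nat list set set" where
  "Nil_of n X = {w \<in> carrier (kiselman n). content w = X}"

definition powerset_monoid :: "nat \<Rightarrow> nat set monoid" where
  "powerset_monoid n = \<lparr> carrier = Pow {1..n}, mult = (\<union>), one = {} \<rparr>"

lemma monoid_kiselman: "monoid (kiselman n)"
  unfolding kiselman_def by (rule monoid_presented_monoid)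

lemma monoid_powerset_monoid: "monoid (powerset_monoid n)"
  by (rule monoidI) (auto simp: powerset_monoid_def)

lemma content_eq_set:
  assumes "w \<in> carrier (kiselman n)" "u \<in> w"
  shows "content w = set u"
proof -
  let ?E = "word_cong {1..n} (kiselman_relations n)"
  have eq: "set x = set y" if "(x, y) \<in> ?E" for x y
    using that by induction (auto simp: kiselman_relations_def)
  obtain v where w: "w = ?E `` {v}"
    using assms(1) by (auto simp: kiselman_def presented_monoid_def elim!: quotientE)
  have "set u = set v" using assms(2) eq w by blast
  moreover have "set x = set v" if "x \<in> w" for x using that eq w by blast
  ultimately show ?thesis using assms(2) by (auto simp: content_def)
qed


section \<open>Isolated and completely isolated subsemigroups\<close>

definition subsemigroup :: "'a set \<Rightarrow> ('a, 'b) monoid_scheme \<Rightarrow> bool" where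
  "subsemigroup T S \<longleftrightarrow>
    T \<subseteq> carrier S \<and> T \<noteq> {} \<and> (\<forall>x\<in>T. \<forall>y\<in>T. x \<otimes>\<^bsub>S\<^esub> y \<in> T)"

definition isolated :: "'a set \<Rightarrow> ('a, 'b) monoid_scheme \<Rightarrow> bool" where
  "isolated T S \<longleftrightarrow>
    subsemigroup T S \<and>
    (\<forall>x\<in>carrier S. (\<exists>l::nat. l \<ge> 1 \<and> x [^]\<^bsub>S\<^esub> l \<in> T) \<longrightarrow> x \<in> T)"

definition completely_isolated :: "'a set \<Rightarrow> ('a, 'b) monoid_scheme \<Rightarrow> bool" where
  "completely_isolated T S \<longleftrightarrow>
    subsemigroup T S \<and>
    (\<forall>x\<in>carrier S. \<forall>y\<in>carrier S. x \<otimes>\<^bsub>S\<^esub> y \<in> T \<longrightarrow> x \<in> T \<or> y \<in> T)"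

definition minimal_isolated :: "'a set \<Rightarrow> ('a, 'b) monoid_scheme \<Rightarrow> bool" where
  "minimal_isolated T S \<longleftrightarrow>
    isolated T S \<and> (\<forall>T'. isolated T' S \<and> T' \<subseteq> T \<longrightarrow> T' = T)"

end

theory Submission imports Defs
begin

text \<open>The letter \<open>m = max X\<close> may be deleted from a word over \<open>X\<close> everywhere to the right of
  its first occurrence. By induction on \<open>|X|\<close>, all elements of content \<open>X\<close> therefore have the
  same \<open>|X|\<close>-th power, namely the zero of the submonoid generated by the \<open>a\<^sub>i\<close>, \<open>i \<in> X\<close>. Hence
  an isolated subsemigroup is a union of fibres of \<open>\<cc>\<close>; conversely, as every element of
  \<open>(2\<^bsup>{1..n}\<^esup>, \<union>)\<close> is idempotent, the preimage under \<open>\<cc>\<close> of a subsemigroup is isolated.\<close>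

section \<open>Epimorphisms onto bands whose fibres share powers\<close>

text \<open>This abstracts the properties of the content map that drive the transfer in both
  directions: \<open>idem\<close> makes preimages of subsemigroups isolated, and
  \<open>fibre_pow\<close> forces isolated subsemigroups to be saturated, that is, unions of
  fibres.\<close>

locale band_epimorphism = M: monoid M + N: monoid N
  for M :: "('a, 'c) monoid_scheme" and N :: "('b, 'd) monoid_scheme" +
  fixes c :: "'a \<Rightarrow> 'b"
  assumes hom: "c \<in> hom M N"
    and surj: "c ` carrier M = carrier N"
    and idem: "b \<in> carrier N \<Longrightarrow> b \<otimes>\<^bsub>N\<^esub> b = b"
    and fibre_pow: "x \<in> carrier M \<Longrightarrow> y \<in> carrier M \<Longrightarrow> c x = c y
      \<Longrightarrow> \<exists>l::nat. l \<ge> 1 \<and> x [^]\<^bsub>M\<^esub> l = y [^]\<^bsub>M\<^esub> l"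
begin

definition preimage :: "'b set \<Rightarrow> 'a set" where
  "preimage T = {x \<in> carrier M. c x \<in> T}"

lemma c_closed: "x \<in> carrier M \<Longrightarrow> c x \<in> carrier N"
  using surj by blast

lemma c_mult: "x \<in> carrier M \<Longrightarrow> y \<in> carrier M \<Longrightarrow> c (x \<otimes>\<^bsub>M\<^esub> y) = c x \<otimes>\<^bsub>N\<^esub> c y"
  using hom by (simp add: hom_def)

text \<open>Idempotence in \<open>N\<close> collapses the powers of \<open>c x\<close>. Exponents
  start at 1, since the zeroth power is the unit whatever \<open>x\<close> is.\<close>

lemma c_pow:
  assumes "x \<in> carrier M"
  shows "c (x [^]\<^bsub>M\<^esub> Suc l) = c x"
  using assms by (induction l) (simp_all add: c_mult c_closed idem)

lemma image_preimage:
  assumes "T \<subseteq> carrier N"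
  shows "c ` preimage T = T"
proof -
  have "c ` preimage T = c ` carrier M \<inter> T" by (auto simp: preimage_def)
  then show ?thesis using assms surj by blast
qed

text \<open>All positive powers of \<open>x\<close> stay in \<open>S\<close>; one of them is also a
  power of \<open>y\<close>, and isolation takes that root.\<close>

lemma isolated_fibre:
  assumes "isolated S M" "x \<in> S" "y \<in> carrier M" "c x = c y"
  shows "y \<in> S"
proof -
  have S: "S \<subseteq> carrier M" "\<forall>x\<in>S. \<forall>y\<in>S. x \<otimes>\<^bsub>M\<^esub> y \<in> S"
    using assms(1) by (auto simp: isolated_def subsemigroup_def)
  have x: "x \<in> carrier M" using S assms(2) by blast
  have pow: "x [^]\<^bsub>M\<^esub> Suc l \<in> S" for l
  proof (induction l)
    case 0
    then show ?case using assms(2) x by simp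
  next
    case (Suc l)
    then have "x [^]\<^bsub>M\<^esub> Suc l \<otimes>\<^bsub>M\<^esub> x \<in> S" using S(2) assms(2) by blast
    then show ?case by simp
  qed
  obtain l :: nat where l: "l \<ge> 1" "x [^]\<^bsub>M\<^esub> l = y [^]\<^bsub>M\<^esub> l"
    using fibre_pow[OF x assms(3,4)] by blast
  then have "y [^]\<^bsub>M\<^esub> l \<in> S"
    using pow[of "l - 1"] by simp
  then show ?thesis
    using assms(1,3) l(1) by (auto simp: isolated_def)
qed

lemma preimage_image:
  assumes "isolated S M"
  shows "preimage (c ` S) = S"
proof
  show "preimage (c ` S) \<subseteq> S"
    using isolated_fibre[OF assms] by (auto simp: preimage_def)
  show "S \<subseteq> preimage (c ` S)"
    using assms by (auto simp: preimage_def isolated_def subsemigroup_def)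
qed

lemma subsemigroup_image:
  assumes "subsemigroup S M"
  shows "subsemigroup (c ` S) N"
  unfolding subsemigroup_def
proof (intro conjI ballI)
  show "c ` S \<subseteq> carrier N" "c ` S \<noteq> {}"
    using assms surj by (auto simp: subsemigroup_def)
next
  fix x y assume "x \<in> c ` S" "y \<in> c ` S"
  then obtain u v where "u \<in> S" "v \<in> S" "x = c u" "y = c v" by blast
  then have "x \<otimes>\<^bsub>N\<^esub> y = c (u \<otimes>\<^bsub>M\<^esub> v)" "u \<otimes>\<^bsub>M\<^esub> v \<in> S"
    using assms by (auto simp: subsemigroup_def c_mult subset_iff)
  then show "x \<otimes>\<^bsub>N\<^esub> y \<in> c ` S" by blast
qed

lemma isolated_preimage:
  assumes "subsemigroup T N"
  shows "isolated (preimage T) M"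
  unfolding isolated_def
proof (intro conjI ballI impI)
  have "T \<subseteq> carrier N" "T \<noteq> {}" using assms by (auto simp: subsemigroup_def)
  then have "preimage T \<noteq> {}" using image_preimage by blast
  then show "subsemigroup (preimage T) M"
    using assms by (auto simp: subsemigroup_def preimage_def c_mult)
next
  fix x assume x: "x \<in> carrier M" "\<exists>l::nat. l \<ge> 1 \<and> x [^]\<^bsub>M\<^esub> l \<in> preimage T"
  then obtain l where "x [^]\<^bsub>M\<^esub> Suc l \<in> preimage T"
    by (metis One_nat_def Suc_le_D)
  then show "x \<in> preimage T"
    using x(1) c_pow[OF x(1), of l] by (simp add: preimage_def del: M.nat_pow_Suc)
qed

theorem isolated_bij:
  "bij_betw ((`) c) {S. isolated S M} {T. subsemigroup T N}"
proof (rule bij_betw_byWitness[where f' = preimage])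
  show "\<forall>S\<in>{S. isolated S M}. preimage (c ` S) = S"
    using preimage_image by blast
  show "\<forall>T\<in>{T. subsemigroup T N}. c ` preimage T = T"
    using image_preimage by (simp add: subsemigroup_def)
  show "(`) c ` {S. isolated S M} \<subseteq> {T. subsemigroup T N}"
    using subsemigroup_image by (auto simp: isolated_def)
  show "preimage ` {T. subsemigroup T N} \<subseteq> {S. isolated S M}"
    using isolated_preimage by blast
qed

lemma isolated_single_fibre:
  assumes "b \<in> carrier N"
  shows "isolated (preimage {b}) M"
  using assms idem by (intro isolated_preimage) (simp add: subsemigroup_def)

text \<open>Each fibre is isolated because its base point is idempotent, and an isolated
  subsemigroup contains the whole fibre of each of its elements. So fibres are the smallest possible
  ones.\<close>

theorem minimal_isolated_iff:
  "minimal_isolated S M \<longleftrightarrow> (\<exists>b\<in>carrier N. S = preimage {b})"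
proof
  assume S: "minimal_isolated S M"
  then have iso: "isolated S M" by (simp add: minimal_isolated_def)
  then obtain x where x: "x \<in> S" "x \<in> carrier M"
    by (auto simp: isolated_def subsemigroup_def)
  have "preimage {c x} \<subseteq> S"
    using isolated_fibre[OF iso x(1)] by (auto simp: preimage_def)
  then have "preimage {c x} = S"
    using S isolated_single_fibre c_closed x(2) by (auto simp: minimal_isolated_def)
  then show "\<exists>b\<in>carrier N. S = preimage {b}"
    using c_closed x(2) by blast
next
  assume "\<exists>b\<in>carrier N. S = preimage {b}"
  then obtain b where b: "b \<in> carrier N" "S = preimage {b}" by blast
  have "T = S" if T: "isolated T M" "T \<subseteq> S" for T
  proof -
    obtain x where x: "x \<in> T" using T(1) by (auto simp: isolated_def subsemigroup_def)
    have "S \<subseteq> T"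
      using isolated_fibre[OF T(1) x] x T(2) b(2) by (auto simp: preimage_def)
    then show ?thesis using T(2) by blast
  qed
  then show "minimal_isolated S M"
    using b isolated_single_fibre by (simp add: minimal_isolated_def)
qed

end

text \<open>Splitting one factor \<open>x\<close> off a power in \<open>S\<close> puts either
  \<open>x\<close> or the next lower power into \<open>S\<close>; descending through the exponents
  ends at \<open>x\<close>.\<close>

lemma (in monoid) completely_isolated_imp_isolated:
  assumes "completely_isolated S G"
  shows "isolated S G"
proof -
  have "x \<in> S" if x: "x \<in> carrier G" and "x [^] Suc l \<in> S" for x l
    using that(2)
  proof (induction l)
    case 0
    then show ?case using x by simp
  next
    case (Suc l)
    then have "x [^] Suc l \<otimes> x \<in> S" by simp
    then have "x [^] Suc l \<in> S \<or> x \<in> S"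
      using assms x nat_pow_closed[OF x, of "Suc l"] unfolding completely_isolated_def by blast
    then show ?case using Suc.IH by blast
  qed
  then show ?thesis
    using assms unfolding isolated_def completely_isolated_def by (metis One_nat_def Suc_le_D)
qed

section \<open>Completely isolated subsemigroups along the epimorphism\<close>

context band_epimorphism
begin

lemma completely_isolated_image:
  assumes "completely_isolated S M"
  shows "completely_isolated (c ` S) N"
  unfolding completely_isolated_def
proof (intro conjI ballI impI)
  show "subsemigroup (c ` S) N"
    using assms subsemigroup_image by (simp add: completely_isolated_def)
next
  fix x y assume xy: "x \<in> carrier N" "y \<in> carrier N" "x \<otimes>\<^bsub>N\<^esub> y \<in> c ` S"
  then obtain u v where uv: "u \<in> carrier M" "v \<in> carrier M" "x = c u" "y = c v"
    using surj by blast
  \<comment> \<open>The lifts are arbitrary, so their product is only known to share a fibre with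
    some element of \<open>S\<close>; saturation of \<open>S\<close> then puts the product itself
    into \<open>S\<close>.\<close>
  have "u \<otimes>\<^bsub>M\<^esub> v \<in> preimage (c ` S)"
    using xy(3) uv by (simp add: preimage_def c_mult)
  then have "u \<otimes>\<^bsub>M\<^esub> v \<in> S"
    using preimage_image M.completely_isolated_imp_isolated[OF assms] by simp
  then have "u \<in> S \<or> v \<in> S"
    using assms uv by (simp add: completely_isolated_def)
  then show "x \<in> c ` S \<or> y \<in> c ` S"
    using uv by blast
qed

lemma completely_isolated_preimage:
  assumes "completely_isolated T N"
  shows "completely_isolated (preimage T) M"
proof -
  have "subsemigroup (preimage T) M"
    using assms isolated_preimage by (simp add: completely_isolated_def isolated_def)
  then show ?thesis
    using assms by (simp add: completely_isolated_def preimage_def c_mult c_closed)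
qed

theorem completely_isolated_bij:
  "bij_betw ((`) c) {S. completely_isolated S M} {T. completely_isolated T N}"
proof (rule bij_betw_byWitness[where f' = preimage])
  show "\<forall>S\<in>{S. completely_isolated S M}. preimage (c ` S) = S"
    using preimage_image M.completely_isolated_imp_isolated by blast
  show "\<forall>T\<in>{T. completely_isolated T N}. c ` preimage T = T"
    using image_preimage by (simp add: completely_isolated_def subsemigroup_def)
  show "(`) c ` {S. completely_isolated S M} \<subseteq> {T. completely_isolated T N}"
    using completely_isolated_image by blast
  show "preimage ` {T. completely_isolated T N} \<subseteq> {S. completely_isolated S M}"
    using completely_isolated_preimage by blast
qed

end

section \<open>Powers in Kiselman's semigroup\<close>

abbreviation kiselman_cong :: "nat \<Rightarrow> (nat list \<times> nat list) set" where
  "kiselman_cong n \<equiv> word_cong {1..n} (kiselman_relations n)"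

declare word_cong.trans [trans]

lemma word_cong_context:
  assumes "(u, v) \<in> word_cong A R" "p \<in> lists A" "q \<in> lists A"
  shows "(p @ u @ q, p @ v @ q) \<in> word_cong A R"
  using assms by (intro word_cong.append word_cong.refl)

lemma kiselman_idem:
  assumes "i \<in> {1..n}"
  shows "([i, i], [i]) \<in> kiselman_cong n"
  using assms by (intro word_cong.rel) (auto simp: kiselman_relations_def)

lemma kiselman_absorb_left:
  assumes "i \<in> {1..n}" "j \<in> {1..n}" "i < j"
  shows "([i, j, i], [j, i]) \<in> kiselman_cong n"
  using assms by (intro word_cong.rel) (auto simp: kiselman_relations_def)

lemma kiselman_absorb_right:
  assumes "i \<in> {1..n}" "j \<in> {1..n}" "i < j"
  shows "([j, i, j], [j, i]) \<in> kiselman_cong n"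
  using assms by (intro word_cong.rel) (auto simp: kiselman_relations_def)

text \<open>The leading \<open>m\<close> is carried through the word: for \<open>a < m\<close> the
  relation \<open>m a = m a m\<close> creates a copy of \<open>m\<close> behind \<open>a\<close>,
  this copy clears the rest by induction, and the same relation removes it again.\<close>

lemma kiselman_delete_max:
  assumes "m \<in> {1..n}" "set t \<subseteq> {1..n}" "\<forall>a\<in>set t. a \<le> m"
  shows "(m # t, m # filter (\<lambda>a. a \<noteq> m) t) \<in> kiselman_cong n"
  using assms(2,3)
proof (induction t)
  case Nil
  then show ?case using assms(1) by (auto intro!: word_cong.refl)
next
  case (Cons a t)
  let ?f = "filter (\<lambda>a. a \<noteq> m)"
  have IH: "(m # t, m # ?f t) \<in> kiselman_cong n" using Cons by simp
  have t: "t \<in> lists {1..n}" "?f t \<in> lists {1..n}" "a \<in> {1..n}" using Cons.prems by auto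
  show ?case
  proof (cases "a = m")
    case True
    have "(m # m # t, m # t) \<in> kiselman_cong n"
      using word_cong_context[OF kiselman_idem[OF assms(1)], of "[]" t] t by simp
    then show ?thesis using IH True by (auto intro: word_cong.trans)
  next
    case False
    then have am: "a < m" using Cons.prems by auto
    note rel = kiselman_absorb_right[OF t(3) assms(1) am]
    have "(m # a # t, m # a # m # t) \<in> kiselman_cong n"
      using word_cong_context[OF word_cong.sym[OF rel], of "[]" t] t by simp
    also have "(m # a # m # t, m # a # m # ?f t) \<in> kiselman_cong n"
      using word_cong_context[OF IH, of "[m, a]" "[]"] t assms(1) by simp
    also have "(m # a # m # ?f t, m # a # ?f t) \<in> kiselman_cong n"
      using word_cong_context[OF rel, of "[]" "?f t"] t by simp
    finally show ?thesis using False by simp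
  qed
qed

section \<open>A common power for all words with the same letters\<close>

lemma filter_concat_replicate:
  "filter P (concat (replicate k w)) = concat (replicate k (filter P w))"
  by (induction k) simp_all

lemma set_concat_replicate_subset: "set (concat (replicate k w)) \<subseteq> set w"
  by (induction k) auto

lemma lists_absorb_left:
  assumes "\<And>a. a \<in> X \<Longrightarrow> (a # z, z) \<in> word_cong A R" "X \<subseteq> A" "z \<in> lists A" "set u \<subseteq> X"
  shows "(u @ z, z) \<in> word_cong A R"
  using assms(4)
proof (induction u)
  case Nil
  then show ?case using assms(3) by (simp add: word_cong.refl)
next
  case (Cons a u)
  then have "(a # u @ z, a # z) \<in> word_cong A R"
    using word_cong_context[of "u @ z" z A R "[a]" "[]"] assms(2) by auto
  then show ?case
    using Cons.prems assms(1)[of a] by (auto intro: word_cong.trans)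
qed

text \<open>Adding letters in increasing order, the witness \<open>z\<close> grows to
  \<open>m # z\<close>, so it lists \<open>X\<close> decreasingly. Absorption of letters on the left
  is part of the induction because it clears the debris around the chosen \<open>m\<close>. Each
  letter of \<open>X\<close> costs one copy of \<open>w\<close>, whence the exponent
  \<open>card X\<close>.\<close>

lemma kiselman_common_power:
  assumes "X \<subseteq> {1..n}"
  shows "\<exists>z. set z = X \<and> (\<forall>a\<in>X. (a # z, z) \<in> kiselman_cong n)
    \<and> (\<forall>w. set w = X \<longrightarrow> (concat (replicate (card X) w), z) \<in> kiselman_cong n)"
proof -
  have "finite X" using assms finite_subset by blast
  then show ?thesis using assms
  proof (induction X rule: finite_linorder_max_induct)
    case empty
    show ?case by (auto intro!: word_cong.refl exI[of _ "[]"])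
  next
    case (insert m X)
    let ?f = "filter (\<lambda>a. a \<noteq> m)"
    obtain z where z: "set z = X" "\<And>a. a \<in> X \<Longrightarrow> (a # z, z) \<in> kiselman_cong n"
      and pow: "\<And>w. set w = X \<Longrightarrow> (concat (replicate (card X) w), z) \<in> kiselman_cong n"
      using insert by auto
    have m: "m \<in> {1..n}" "X \<subseteq> {1..n}" "m \<notin> X" using insert by auto
    have zl: "z \<in> lists {1..n}" "m # z \<in> lists {1..n}" using z(1) m by auto
    have absorb: "(a # m # z, m # z) \<in> kiselman_cong n" if "a \<in> insert m X" for a
    proof (cases "a = m")
      case True
      then show ?thesis
        using word_cong_context[OF kiselman_idem[OF m(1)], of "[]" z] zl by simp
    next
      case False
      then have a: "a \<in> X" "a \<in> {1..n}" "a < m" using that insert m by auto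
      \<comment> \<open>Since \<open>z\<close> absorbs \<open>a\<close>, a copy of \<open>a\<close>
        can be drawn out of \<open>z\<close> to form the factor \<open>a m a\<close>. It reduces to
        \<open>m a\<close>, and \<open>z\<close> swallows \<open>a\<close> again.\<close>
      have az: "(m # a # z, m # z) \<in> kiselman_cong n"
        using word_cong_context[OF z(2)[OF a(1)], of "[m]" "[]"] m(1) by simp
      have "(a # m # z, a # m # a # z) \<in> kiselman_cong n"
        using word_cong_context[OF word_cong.sym[OF az], of "[a]" "[]"] a(2) by simp
      also have "(a # m # a # z, m # a # z) \<in> kiselman_cong n"
        using word_cong_context[OF kiselman_absorb_left[OF a(2) m(1) a(3)], of "[]" z] zl by simp
      also note az
      finally show ?thesis .
    qed
    have "(concat (replicate (card (insert m X)) w), m # z) \<in> kiselman_cong n"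
      if w: "set w = insert m X" for w
    proof -
      \<comment> \<open>Of the \<open>card X + 1\<close> copies of \<open>w\<close>, the first
        supplies an \<open>m\<close> that deletes every later \<open>m\<close>, including those in
        the remaining copies \<open>?w\<close>.\<close>
      let ?k = "card X" and ?w = "concat (replicate (card X) w)"
      \<comment> \<open>Any occurrence of \<open>m\<close> will do: \<open>p\<close> may contain
        \<open>m\<close> too, since the final absorption of \<open>p\<close> covers all letters of
        \<open>insert m X\<close>.\<close>
      obtain p q where pq: "w = p @ m # q" using w by (metis insertI1 split_list)
      have sub: "set p \<subseteq> insert m X" "set q \<subseteq> insert m X" using pq w by auto
      have wk: "set ?w \<subseteq> insert m X" using set_concat_replicate_subset[of ?k w] unfolding w .
      have lists: "p \<in> lists {1..n}" "?f q \<in> lists {1..n}" using sub m by auto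
      \<comment> \<open>Without \<open>m\<close>, each remaining copy of \<open>w\<close> has letter
        set exactly \<open>X\<close>, so the induction hypothesis applies to their product.\<close>
      have fw: "(concat (replicate ?k (?f w)), z) \<in> kiselman_cong n"
        using w m(3) by (intro pow) auto
      have "set (q @ ?w) \<subseteq> insert m X" using sub wk by simp
      moreover have "insert m X \<subseteq> {1..n}" "\<forall>a\<in>insert m X. a \<le> m"
        using insert by auto
      ultimately have "(m # q @ ?w, m # ?f (q @ ?w)) \<in> kiselman_cong n"
        by (intro kiselman_delete_max[OF m(1)]) blast+
      then have "(m # q @ ?w, m # ?f q @ concat (replicate ?k (?f w))) \<in> kiselman_cong n"
        by (simp add: filter_concat_replicate)
      also have "(m # ?f q @ concat (replicate ?k (?f w)), m # ?f q @ z) \<in> kiselman_cong n"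
        using word_cong_context[OF fw, of "m # ?f q" "[]"] lists m(1) by simp
      also have "(?f q @ z, z) \<in> kiselman_cong n"
        using sub by (intro lists_absorb_left[OF z(2) m(2) zl(1)]) auto
      then have "(m # ?f q @ z, m # z) \<in> kiselman_cong n"
        using word_cong_context[of "?f q @ z" z _ _ "[m]" "[]"] m(1) by simp
      finally have "(m # q @ ?w, m # z) \<in> kiselman_cong n" .
      then have "(p @ m # q @ ?w, p @ m # z) \<in> kiselman_cong n"
        using lists(1) by (intro word_cong.append word_cong.refl)
      also have "(p @ m # z, m # z) \<in> kiselman_cong n"
        using lists_absorb_left[OF absorb insert.prems zl(2) sub(1)] by simp
      finally show ?thesis
        using insert(1) m(3) pq by simp
    qed
    then show ?case
      using absorb z(1) by (intro exI[of _ "m # z"]) auto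
  qed
qed

section \<open>From words to elements of the semigroup\<close>

abbreviation kiselman_class :: "nat \<Rightarrow> nat list \<Rightarrow> nat list set" where
  "kiselman_class n u \<equiv> kiselman_cong n `` {u}"

lemma kiselman_carrierE:
  assumes "x \<in> carrier (kiselman n)"
  obtains u where "u \<in> lists {1..n}" "x = kiselman_class n u"
  using assms by (auto simp: kiselman_def presented_monoid_def elim!: quotientE)

lemma kiselman_class_closed:
  "u \<in> lists {1..n} \<Longrightarrow> kiselman_class n u \<in> carrier (kiselman n)"
  by (auto simp: kiselman_def presented_monoid_def intro: quotientI)

lemma kiselman_class_mult:
  "u \<in> lists {1..n} \<Longrightarrow> v \<in> lists {1..n} \<Longrightarrow>
    kiselman_class n u \<otimes>\<^bsub>kiselman n\<^esub> kiselman_class n v = kiselman_class n (u @ v)"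
  unfolding kiselman_def by (rule presented_monoid_mult)

lemma content_kiselman_class:
  "u \<in> lists {1..n} \<Longrightarrow> content (kiselman_class n u) = set u"
  by (rule content_eq_set[OF kiselman_class_closed]) (auto intro: word_cong.refl)

lemma kiselman_class_pow:
  assumes "u \<in> lists {1..n}"
  shows "kiselman_class n u [^]\<^bsub>kiselman n\<^esub> k = kiselman_class n (concat (replicate k u))"
proof (induction k)
  case 0
  then show ?case by (simp add: kiselman_def presented_monoid_def nat_pow_def)
next
  case (Suc k)
  have "concat (replicate k u) \<in> lists {1..n}"
    using set_concat_replicate_subset[of k u] assms by auto
  then have "kiselman_class n u \<otimes>\<^bsub>kiselman n\<^esub> kiselman_class n (concat (replicate k u))
      = kiselman_class n (concat (replicate (Suc k) u))"
    using kiselman_class_mult[OF assms] by simp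
  \<comment> \<open>Powers are defined by multiplying on the right, whereas
    \<open>replicate (Suc k) u\<close> puts the new copy in front; \<open>nat_pow_Suc2\<close>
    reconciles the two.\<close>
  then show ?case
    unfolding monoid.nat_pow_Suc2[OF monoid_kiselman kiselman_class_closed[OF assms]] Suc .
qed

lemma content_subset:
  assumes "x \<in> carrier (kiselman n)"
  shows "content x \<subseteq> {1..n}"
proof -
  obtain u where "u \<in> lists {1..n}" "x = kiselman_class n u"
    using assms by (rule kiselman_carrierE)
  then show ?thesis using content_kiselman_class by blast
qed

lemma content_mult:
  assumes "x \<in> carrier (kiselman n)" "y \<in> carrier (kiselman n)"
  shows "content (x \<otimes>\<^bsub>kiselman n\<^esub> y) = content x \<union> content y"
proof -
  obtain u where u: "u \<in> lists {1..n}" "x = kiselman_class n u"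
    using assms(1) by (rule kiselman_carrierE)
  obtain v where v: "v \<in> lists {1..n}" "y = kiselman_class n v"
    using assms(2) by (rule kiselman_carrierE)
  have "u @ v \<in> lists {1..n}" using u v by simp
  then show ?thesis
    unfolding u(2) v(2) kiselman_class_mult[OF u(1) v(1)] content_kiselman_class[OF u(1)]
      content_kiselman_class[OF v(1)]
    by (simp only: content_kiselman_class set_append)
qed

text \<open>Both powers equal the class of the word \<open>z\<close> that depends only on the common
  content.\<close>

lemma kiselman_fibre_pow:
  assumes "x \<in> carrier (kiselman n)" "y \<in> carrier (kiselman n)" "content x = content y"
  shows "\<exists>l::nat. l \<ge> 1 \<and> x [^]\<^bsub>kiselman n\<^esub> l = y [^]\<^bsub>kiselman n\<^esub> l"
proof -
  let ?k = "card (content x)"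
  have sub: "content x \<subseteq> {1..n}"
    using assms(1) by (rule content_subset)
  obtain z where z: "set z = content x"
    "\<And>a. a \<in> content x \<Longrightarrow> (a # z, z) \<in> kiselman_cong n"
    "\<And>w. set w = content x \<Longrightarrow> (concat (replicate ?k w), z) \<in> kiselman_cong n"
    using kiselman_common_power[OF sub] by blast
  \<comment> \<open>The exponent is \<open>Suc ?k\<close> because \<open>?k\<close> is 0 for empty
    content, while a positive exponent is required; \<open>z\<close> absorbs the extra factor on the
    left.\<close>
  have "t [^]\<^bsub>kiselman n\<^esub> Suc ?k = kiselman_class n z"
    if t: "t \<in> carrier (kiselman n)" "content t = content x" for t
  proof -
    obtain u where u: "u \<in> lists {1..n}" "t = kiselman_class n u"
      using t(1) by (rule kiselman_carrierE)
    then have su: "set u = content x" using t(2) content_kiselman_class by simp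
    have "(u @ concat (replicate ?k u), u @ z) \<in> kiselman_cong n"
      using z(3)[OF su] u(1) by (intro word_cong.append word_cong.refl)
    also have "(u @ z, z) \<in> kiselman_cong n"
      using z(1) su sub by (intro lists_absorb_left[OF z(2) sub]) auto
    finally have "kiselman_class n (u @ concat (replicate ?k u)) = kiselman_class n z"
      by (rule equiv_class_eq[OF equiv_word_cong])
    then show ?thesis
      using u kiselman_class_pow[OF u(1), of "Suc ?k"] by simp
  qed
  from this[OF assms(1)] this[OF assms(2)]
  have "x [^]\<^bsub>kiselman n\<^esub> Suc ?k = y [^]\<^bsub>kiselman n\<^esub> Suc ?k"
    using assms(3) by simp
  then show ?thesis by (intro exI[of _ "Suc ?k"]) simp
qed

section \<open>The content map as an instance, and the conclusion\<close>

lemma band_epimorphism_content: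
  "band_epimorphism (kiselman n) (powerset_monoid n) content"
proof (intro band_epimorphism.intro band_epimorphism_axioms.intro
    monoid_kiselman monoid_powerset_monoid kiselman_fibre_pow)
  show "content \<in> hom (kiselman n) (powerset_monoid n)"
    using content_subset monoid.m_closed[OF monoid_kiselman]
    by (auto simp: hom_def powerset_monoid_def content_mult simp del: atLeastAtMost_iff)
  \<comment> \<open>Surjectivity: any word listing the elements of the finite set \<open>X\<close>
    represents an element with content \<open>X\<close>.\<close>
  have "X \<in> content ` carrier (kiselman n)" if "X \<subseteq> {1..n}" for X
  proof -
    have "finite X" using that finite_subset by blast
    then obtain u where "set u = X" using finite_list by blast
    then show ?thesis
      using that kiselman_class_closed[of u n] content_kiselman_class[of u n]
      by (intro image_eqI[of _ _ "kiselman_class n u"]) auto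
  qed
  then show "content ` carrier (kiselman n) = carrier (powerset_monoid n)"
    using content_subset by (fastforce simp: powerset_monoid_def simp del: atLeastAtMost_iff)
qed (simp_all add: powerset_monoid_def)

theorem proposition27:
  fixes n :: nat
  assumes "n \<ge> 1"
  shows "bij_betw (\<lambda>S. content ` S)
           {S. isolated S (kiselman n)}
           {T. subsemigroup T (powerset_monoid n)}
       \<and> {S. minimal_isolated S (kiselman n)} = {Nil_of n X | X. X \<subseteq> {1..n}}
       \<and> bij_betw (\<lambda>S. content ` S)
           {S. completely_isolated S (kiselman n)}
           {T. completely_isolated T (powerset_monoid n)}"
proof -
  interpret band_epimorphism "kiselman n" "powerset_monoid n" content
    by (rule band_epimorphism_content)
  \<comment> \<open>This identifies the abstract fibres in \<open>minimal_isolated_iff\<close> with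
    the sets Nil(X).\<close>
  have "preimage {X} = Nil_of n X" for X
    by (simp add: preimage_def Nil_of_def)
  then have "{S. minimal_isolated S (kiselman n)} = {Nil_of n X | X. X \<subseteq> {1..n}}"
    by (auto simp: minimal_isolated_iff powerset_monoid_def)
  then show ?thesis
    using isolated_bij completely_isolated_bij by simp
qed

end
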